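(* For every integer $n\ge 1$: (i) $|\Pi_n|=\det(H^{(1)}_n)=2^{n(n+1)/2}$, and (ii) $|\Omega_n|=\det(G^{(1)}_n)=2^{n(n-1)/2}$.
   Context: Schröder paths and numbers: a large Schröder path of length $n$ is a lattice path in $\mathbb{Z}\times\mathbb{Z}$ from $(0,0)$ to $(2n,0)$ using up steps $(1,1)$, down steps $(1,-1)$ and level steps $(2,0)$ that never passes below the $x$-axis. A small Schröder path of length $n$ (for $n\ge 1$) is a large Schröder path of length $n$ with no level steps on the $x$-axis. The large Schröder number $r_n$ is the number of large Schröder paths of length $n$ ($\{r_n\}_{n\ge 0}=1,2,6,22,90,394,1806,\dots$). The small Schröder numbers are given by $s_0=1$ and, for $n\ge 1$, $s_n$ is the number of small Schröder paths of length $n$ ($\{s_n\}_{n\ge 0}=1,1,3,11,45,197,903,\dots$); for $n\ge1$, $r_n=2s_n$. The same terms (large/small Schröder path) are used for horizontal translates of such paths, i.e. paths between two points of the $x$-axis. Hankel matrices: $H^{(1)}_n$ is the $n\times n$ matrix with $(i,j)$-entry $r_{i+j-1}$, and $G^{(1)}_n$ is the $n\times n$ matrix with $(i,j)$-entry $s_{i+j-1}$, $1\le i,j\le n$. Families of paths: $\Pi_n$ (resp. $\Omega_n$) is the set of $n$-tuples $(\pi_1,\dots,\pi_n)$ of large Schröder paths (resp. small Schröder paths) such that (A1) $\pi_i$ goes from $(-2i+1,0)$ to $(2i-1,0)$ for $1\le i\le n$, and (A2) any two paths $\pi_i$ and $\pi_j$ with $i\ne j$ do not intersect (have no point in common). 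*)

theory Defs
  imports "Jordan_Normal_Form.Determinant" "HOL-Library.FuncSet"
begin

text \<open>
  A lattice path is given by the list of the lattice points that it visits; a level step \<open>(2,0)\<close>
  does not visit its midpoint.
\<close>

type_synonym path = "(int \<times> int) list"

definition is_step :: "int \<times> int \<Rightarrow> int \<times> int \<Rightarrow> bool" where
  "is_step p q \<longleftrightarrow> (fst q - fst p, snd q - snd p) \<in> {(1, 1), (1, -1), (2, 0)}"

definition is_axis_level_step :: "int \<times> int \<Rightarrow> int \<times> int \<Rightarrow> bool" where
  "is_axis_level_step p q \<longleftrightarrow> fst q - fst p = 2 \<and> snd p = 0 \<and> snd q = 0"

definition large_paths :: "int \<Rightarrow> int \<Rightarrow> path set" where
  "large_paths a b = {w. w \<noteq> [] \<and> hd w = (a, 0) \<and> last w = (b, 0) \<and>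
     successively is_step w \<and> (\<forall>p \<in> set w. snd p \<ge> 0)}"

definition small_paths :: "int \<Rightarrow> int \<Rightarrow> path set" where
  "small_paths a b = {w \<in> large_paths a b. successively (\<lambda>p q. \<not> is_axis_level_step p q) w}"

definition large_schroeder :: "nat \<Rightarrow> nat" where
  "large_schroeder n = card (large_paths 0 (2 * int n))"

definition small_schroeder :: "nat \<Rightarrow> nat" where
  "small_schroeder n = (if n = 0 then 1 else card (small_paths 0 (2 * int n)))"

text \<open>
  Matrix indices start at \<open>0\<close> here, so the entry \<open>r\<^sub>i\<^sub>+\<^sub>j\<^sub>-\<^sub>1\<close> for \<open>1 \<le> i, j \<le> n\<close>
  becomes \<open>r\<^sub>i\<^sub>+\<^sub>j\<^sub>+\<^sub>1\<close> for \<open>0 \<le> i, j < n\<close>.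
\<close>

definition H1 :: "nat \<Rightarrow> int mat" where
  "H1 n = mat n n (\<lambda>(i, j). int (large_schroeder (i + j + 1)))"

definition G1 :: "nat \<Rightarrow> int mat" where
  "G1 n = mat n n (\<lambda>(i, j). int (small_schroeder (i + j + 1)))"

text \<open>
  Two paths intersect if they visit a common lattice point. For the families below this is the same
  as having a common point as plane curves: every visited point \<open>(x, y)\<close> has \<open>x + y\<close> odd, and so
  two such paths can only meet in points that both of them visit, or along a common step.
\<close>

definition nonintersecting :: "nat \<Rightarrow> (nat \<Rightarrow> path) \<Rightarrow> bool" where
  "nonintersecting n \<pi> \<longleftrightarrow>
     (\<forall>i \<in> {1..n}. \<forall>j \<in> {1..n}. i \<noteq> j \<longrightarrow> set (\<pi> i) \<inter> set (\<pi> j) = {})"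

definition large_families :: "nat \<Rightarrow> (nat \<Rightarrow> path) set" where
  "large_families n =
     {\<pi> \<in> (\<Pi>\<^sub>E i \<in> {1..n}. large_paths (- 2 * int i + 1) (2 * int i - 1)). nonintersecting n \<pi>}"

definition small_families :: "nat \<Rightarrow> (nat \<Rightarrow> path) set" where
  "small_families n =
     {\<pi> \<in> (\<Pi>\<^sub>E i \<in> {1..n}. small_paths (- 2 * int i + 1) (2 * int i - 1)). nonintersecting n \<pi>}"

end

theory Submission
  imports Defs "HOL-Library.Disjoint_Sets"
begin

text \<open>
  Two relations between the numbers of families, used in turn, give both evaluations by induction.
  
  The first one is geometric. All vertices \<open>(x, y)\<close> of the paths have \<open>x + y\<close> odd, so on the axis only the
  points \<open>\<plusminus>(2k - 1)\<close> can be visited, and each of them is an end point of some path. In a nonintersecting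
  family of small paths, the points \<open>\<plusminus>(2k - 2)\<close> at height \<open>1\<close> are occupied in the same way, because a small
  path starts with an up step and ends with a down step. Therefore \<open>\<pi>\<^sub>1\<close> is \<open>UD\<close>, and for \<open>i > 1\<close>
  the path \<open>\<pi>\<^sub>i\<close> has the form \<open>UUwDD\<close>. The inner parts \<open>w\<close> can be any nonintersecting family of
  large paths, and so \<open>|\<Omega>\<^sub>n\<^sub>+\<^sub>1| = |\<Pi>\<^sub>n|\<close> (\<open>bij_betw_lift_family\<close>).
  
  The second one is algebraic. Since \<open>r\<^sub>n = 2 s\<^sub>n\<close> for \<open>n \<ge> 1\<close> (\<open>large_schroeder_eq_twice_small\<close>), the
  first Hankel matrix is twice the second one, and \<open>det H = 2\<^sup>n det G\<close>. The determinants count the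
  families by the lemma of Lindstroem, Gessel and Viennot (\<open>lindstroem_gessel_viennot\<close>). It
  applies because two paths whose spans overlap without being nested must meet (\<open>large_paths_cross\<close>), so
  that only the identity permutation admits nonintersecting families. Hence \<open>|\<Pi>\<^sub>n| = 2\<^sup>n |\<Omega>\<^sub>n|\<close>.
  
  Together, \<open>|\<Pi>\<^sub>n| = 2\<^sup>n |\<Pi>\<^sub>n\<^sub>-\<^sub>1|\<close>, which makes the exponent a triangular number.
\<close>

section \<open>The lemma of Lindstroem, Gessel and Viennot\<close>

definition paths :: "('v \<Rightarrow> 'v \<Rightarrow> bool) \<Rightarrow> 'v \<Rightarrow> 'v \<Rightarrow> 'v list set" where
  "paths E a b = {w. w \<noteq> [] \<and> hd w = a \<and> last w = b \<and> successively E w}"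

text \<open>
  Follow \<open>w\<close> until its first visit to \<open>v\<close>, and from there on follow \<open>w'\<close>. If both paths visit \<open>v\<close>,
  the second half starts with \<open>v\<close>, so swapping twice at the same vertex restores the paths.
\<close>

definition swap_tails :: "'v \<Rightarrow> 'v list \<Rightarrow> 'v list \<Rightarrow> 'v list" where
  "swap_tails v w w' = takeWhile (\<lambda>u. u \<noteq> v) w @ dropWhile (\<lambda>u. u \<noteq> v) w'"

lemma swap_tails_split:
  assumes "v \<notin> set p" "v \<notin> set p'"
  shows "swap_tails v (p @ v # s) (p' @ v # s') = p @ v # s'"
proof -
  have "takeWhile (\<lambda>u. u \<noteq> v) (p @ v # s) = p"
    using assms by (induction p) auto
  moreover have "dropWhile (\<lambda>u. u \<noteq> v) (p' @ v # s') = v # s'"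
    using assms by (induction p') auto
  ultimately show ?thesis
    by (simp add: swap_tails_def)
qed

lemma swap_tails_in_paths:
  assumes "w \<in> paths E a b" "w' \<in> paths E a' b'" "v \<in> set w" "v \<in> set w'"
  shows "swap_tails v w w' \<in> paths E a b'"
proof -
  obtain p s where w: "w = p @ v # s" "v \<notin> set p"
    using split_list_first[OF assms(3)] by blast
  obtain p' s' where w': "w' = p' @ v # s'" "v \<notin> set p'"
    using split_list_first[OF assms(4)] by blast
  have "p @ v # s' \<in> paths E a b'"
    using assms(1,2) by (auto simp: paths_def w w' successively_append_iff hd_append split: if_splits)
  then show ?thesis
    by (simp add: w w' swap_tails_split)
qed

lemma swap_tails_twice:
  assumes "v \<in> set w" "v \<in> set w'"
  shows "swap_tails v (swap_tails v w w') (swap_tails v w' w) = w"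
proof -
  obtain p s where w: "w = p @ v # s" "v \<notin> set p"
    using split_list_first[OF assms(1)] by blast
  obtain p' s' where w': "w' = p' @ v # s'" "v \<notin> set p'"
    using split_list_first[OF assms(2)] by blast
  show ?thesis
    by (simp add: w w' swap_tails_split)
qed

lemma mem_swap_tails: "v \<in> set w' \<Longrightarrow> v \<in> set (swap_tails v w w')"
  by (auto simp: swap_tails_def dropWhile_append dest!: split_list_first split: if_splits)

text \<open>
  The number of visits to a vertex, taken over a whole family, is thus invariant under swaps. This makes
  the vertex at which a family is swapped recoverable from the swapped family.
\<close>

lemma count_list_swap_tails:
  "count_list (swap_tails v w w') u + count_list (swap_tails v w' w) u
     = count_list w u + count_list w' u"
proof -
  have "count_list x u = count_list (takeWhile (\<lambda>u. u \<noteq> v) x) u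
      + count_list (dropWhile (\<lambda>u. u \<noteq> v) x) u" for x
    by (metis count_list_append takeWhile_dropWhile_id)
  from this[of w] this[of w'] show ?thesis
    by (simp add: swap_tails_def)
qed

definition swap_at :: "'v \<Rightarrow> nat \<Rightarrow> nat \<Rightarrow> (nat \<Rightarrow> 'v list) \<Rightarrow> nat \<Rightarrow> 'v list" where
  "swap_at v i j \<pi> = \<pi>(i := swap_tails v (\<pi> i) (\<pi> j), j := swap_tails v (\<pi> j) (\<pi> i))"

text \<open>
  A swap keeps the number of visits to each vertex, and it keeps the set of paths through the vertex
  at which it happens. The choices below look at nothing else, so an arbitrary choice operator
  makes the same choice before and after the swap.
\<close>

definition multiplicity_in :: "nat set \<Rightarrow> (nat \<Rightarrow> 'v list) \<Rightarrow> 'v \<Rightarrow> nat" where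
  "multiplicity_in I \<pi> u = (\<Sum>k\<in>I. count_list (\<pi> k) u)"

definition visitors :: "nat set \<Rightarrow> (nat \<Rightarrow> 'v list) \<Rightarrow> 'v \<Rightarrow> nat set" where
  "visitors I \<pi> v = {k \<in> I. v \<in> set (\<pi> k)}"

definition meeting_vertex :: "nat set \<Rightarrow> (nat \<Rightarrow> 'v list) \<Rightarrow> 'v" where
  "meeting_vertex I \<pi> = (SOME v. multiplicity_in I \<pi> v \<ge> 2)"

definition meeting_pair :: "nat set \<Rightarrow> (nat \<Rightarrow> 'v list) \<Rightarrow> nat \<times> nat" where
  "meeting_pair I \<pi> =
     (SOME (i, j). i \<noteq> j \<and> {i, j} \<subseteq> visitors I \<pi> (meeting_vertex I \<pi>))"

lemma multiplicity_in_swap_at: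
  fixes \<pi> :: "nat \<Rightarrow> 'v list"
  assumes "finite I" "i \<in> I" "j \<in> I" "i \<noteq> j"
  shows "multiplicity_in I (swap_at v i j \<pi>) = multiplicity_in I \<pi>"
proof
  fix u :: 'v
  have split: "multiplicity_in I \<rho> u
      = count_list (\<rho> i) u + count_list (\<rho> j) u + (\<Sum>k\<in>I - {i, j}. count_list (\<rho> k) u)" for \<rho> :: "nat \<Rightarrow> 'v list"
    using assms sum.subset_diff[of "{i, j}" I "\<lambda>k. count_list (\<rho> k) u"]
    by (simp add: multiplicity_in_def)
  show "multiplicity_in I (swap_at v i j \<pi>) u = multiplicity_in I \<pi> u"
    using assms(4) count_list_swap_tails[of v "\<pi> i" "\<pi> j" u]
    by (simp add: split swap_at_def)
qed

lemma visitors_swap_at: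
  assumes "{i, j} \<subseteq> visitors I \<pi> v"
  shows "visitors I (swap_at v i j \<pi>) v = visitors I \<pi> v"
  using assms by (auto simp: visitors_def swap_at_def mem_swap_tails)

lemma swap_at_twice:
  assumes "{i, j} \<subseteq> visitors I \<pi> v" "i \<noteq> j"
  shows "swap_at v i j (swap_at v i j \<pi>) = \<pi>"
  using assms by (auto simp: visitors_def swap_at_def swap_tails_twice fun_eq_iff)

lemma count_list_distinct: "distinct w \<Longrightarrow> count_list w v = (if v \<in> set w then 1 else 0)"
  by (induction w) auto

text \<open>
  As no path visits a vertex twice, a vertex with two visits lies on two different paths.
\<close>

lemma multiplicity_and_intersections:
  assumes fin: "finite I" and dist: "\<And>k. k \<in> I \<Longrightarrow> distinct (\<pi> k)"
  shows "disjoint_family_on (\<lambda>k. set (\<pi> k)) I \<longleftrightarrow> (\<forall>v. multiplicity_in I \<pi> v < 2)"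
    and "multiplicity_in I \<pi> v \<ge> 2 \<Longrightarrow> \<exists>i j. i \<noteq> j \<and> {i, j} \<subseteq> visitors I \<pi> v"
proof -
  have mult: "multiplicity_in I \<pi> v = card (visitors I \<pi> v)" for v
  proof -
    have "multiplicity_in I \<pi> v = (\<Sum>k\<in>I. if v \<in> set (\<pi> k) then 1 else 0)"
      unfolding multiplicity_in_def
      by (rule sum.cong) (auto simp: count_list_distinct dist)
    also have "\<dots> = card (visitors I \<pi> v)"
      using fin by (simp add: visitors_def sum.If_cases Int_def)
    finally show ?thesis .
  qed
  have pair: "multiplicity_in I \<pi> v \<ge> 2 \<longleftrightarrow> (\<exists>i j. i \<noteq> j \<and> {i, j} \<subseteq> visitors I \<pi> v)" for v
  proof -
    have f: "finite (visitors I \<pi> v)"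
      using fin by (simp add: visitors_def)
    have "card (visitors I \<pi> v) \<ge> 2 \<longleftrightarrow> \<not> card (visitors I \<pi> v) \<le> Suc 0"
      by auto
    then show ?thesis
      unfolding mult by (auto simp: card_le_Suc0_iff_eq[OF f])
  qed
  show "disjoint_family_on (\<lambda>k. set (\<pi> k)) I \<longleftrightarrow> (\<forall>v. multiplicity_in I \<pi> v < 2)"
    unfolding not_le[symmetric] pair by (auto simp: disjoint_family_on_def visitors_def)
  show "multiplicity_in I \<pi> v \<ge> 2 \<Longrightarrow> \<exists>i j. i \<noteq> j \<and> {i, j} \<subseteq> visitors I \<pi> v"
    using pair by blast
qed

definition families ::
    "('v \<Rightarrow> 'v \<Rightarrow> bool) \<Rightarrow> (nat \<Rightarrow> 'v) \<Rightarrow> (nat \<Rightarrow> 'v) \<Rightarrow> nat set \<Rightarrow> (nat \<Rightarrow> nat) \<Rightarrow> (nat \<Rightarrow> 'v list) set" where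
  "families E A B I \<sigma> = (\<Pi>\<^sub>E i\<in>I. paths E (A i) (B (\<sigma> i)))"

lemma sum_eq_0_by_sign_reversing_involution:
  fixes f :: "'a \<Rightarrow> int"
  assumes "\<And>x. x \<in> S \<Longrightarrow> \<phi> x \<in> S" "\<And>x. x \<in> S \<Longrightarrow> \<phi> (\<phi> x) = x" "\<And>x. x \<in> S \<Longrightarrow> f (\<phi> x) = - f x"
  shows "sum f S = 0"
proof -
  have "sum f S = (\<Sum>x\<in>S. - f x)"
    by (rule sum.reindex_bij_witness[of _ \<phi> \<phi>]) (simp_all add: assms)
  then show ?thesis
    by (simp add: sum_negf)
qed

text \<open>
  Swapping two tails exchanges the sinks of two paths, which changes the sign of the permutation and
  nothing else: the intersecting families cancel in pairs.
\<close>

lemma signed_sum_over_intersecting_families: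
  assumes acyclic: "\<And>w. successively E w \<Longrightarrow> distinct w"
    and I: "finite I"
  shows "(\<Sum>(\<sigma>, \<pi>)\<in>(SIGMA \<sigma>:{\<sigma>. \<sigma> permutes I}.
           {\<pi> \<in> families E A B I \<sigma>. \<not> disjoint_family_on (\<lambda>k. set (\<pi> k)) I}). sign \<sigma> :: int) = 0"
    (is "sum _ ?S = 0")
proof -
  define \<phi> where "\<phi> = (\<lambda>(\<sigma> :: nat \<Rightarrow> nat, \<pi> :: nat \<Rightarrow> 'a list).
    case meeting_pair I \<pi> of (i, j) \<Rightarrow>
      (\<sigma> \<circ> Transposition.transpose i j, swap_at (meeting_vertex I \<pi>) i j \<pi>))"
  let ?f = "\<lambda>(\<sigma>, \<pi>). sign \<sigma> :: int"
  have key: "\<phi> x \<in> ?S \<and> \<phi> (\<phi> x) = x \<and> ?f (\<phi> x) = - ?f x"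
    if x_in: "x \<in> ?S" for x
  proof -
    obtain \<sigma> \<pi> where x: "x = (\<sigma>, \<pi>)"
      by (cases x)
    with x_in have \<sigma>: "\<sigma> permutes I" and \<pi>: "\<pi> \<in> families E A B I \<sigma>"
      and meet: "\<not> disjoint_family_on (\<lambda>k. set (\<pi> k)) I"
      by simp_all
    have distinct: "distinct (\<rho> k)" if "\<rho> \<in> families E A B I \<tau>" "k \<in> I" for \<rho> \<tau> k
    proof -
      have "successively E (\<rho> k)"
        using that by (auto simp: families_def paths_def PiE_iff)
      then show ?thesis
        by (rule acyclic)
    qed
    note dist = distinct[OF \<pi>]
    define v where "v = meeting_vertex I \<pi>"
    have "\<exists>v. multiplicity_in I \<pi> v \<ge> 2"
      using meet multiplicity_and_intersections(1)[OF I dist] by (simp add: not_less)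
    then have v: "multiplicity_in I \<pi> v \<ge> 2"
      unfolding v_def meeting_vertex_def by (rule someI_ex)
    obtain i j where ij: "meeting_pair I \<pi> = (i, j)"
      by fastforce
    have "\<exists>p. case p of (i, j) \<Rightarrow> i \<noteq> j \<and> {i, j} \<subseteq> visitors I \<pi> v"
      using multiplicity_and_intersections(2)[OF I dist v] by auto
    from someI_ex[OF this] have vis: "i \<noteq> j" "{i, j} \<subseteq> visitors I \<pi> v"
      using ij unfolding meeting_pair_def v_def by auto
    then have I_ij: "i \<in> I" "j \<in> I" and v_ij: "v \<in> set (\<pi> i)" "v \<in> set (\<pi> j)"
      by (auto simp: visitors_def)
    define \<tau> \<rho> where "\<tau> = \<sigma> \<circ> Transposition.transpose i j" and "\<rho> = swap_at v i j \<pi>"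
    have \<phi>x: "\<phi> x = (\<tau>, \<rho>)"
      by (simp add: \<phi>_def x ij \<tau>_def \<rho>_def v_def)
    have \<tau>: "\<tau> permutes I"
      unfolding \<tau>_def using \<sigma> I_ij by (intro permutes_compose permutes_swap_id)
    have mult: "multiplicity_in I \<rho> = multiplicity_in I \<pi>"
      unfolding \<rho>_def using I I_ij vis(1) by (rule multiplicity_in_swap_at)
    have vertex: "meeting_vertex I \<rho> = v"
      by (simp add: meeting_vertex_def mult v_def)
    have pair: "meeting_pair I \<rho> = (i, j)"
      unfolding meeting_pair_def vertex
      using ij visitors_swap_at[OF vis(2)] by (simp add: \<rho>_def meeting_pair_def v_def)
    have \<rho>: "\<rho> \<in> families E A B I \<tau>"
    proof -
      have "\<pi> i \<in> paths E (A i) (B (\<sigma> i))" "\<pi> j \<in> paths E (A j) (B (\<sigma> j))"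
        using \<pi> I_ij by (auto simp: families_def)
      then have "swap_tails v (\<pi> i) (\<pi> j) \<in> paths E (A i) (B (\<sigma> j))"
        "swap_tails v (\<pi> j) (\<pi> i) \<in> paths E (A j) (B (\<sigma> i))"
        using v_ij by (auto intro: swap_tails_in_paths)
      then show ?thesis
        using \<pi> I_ij vis(1)
        by (auto simp: families_def PiE_iff \<rho>_def \<tau>_def swap_at_def extensional_def transpose_def)
    qed
    have "\<not> disjoint_family_on (\<lambda>k. set (\<rho> k)) I"
      using meet multiplicity_and_intersections(1)[OF I dist]
        multiplicity_and_intersections(1)[OF I distinct[OF \<rho>]] mult by simp
    moreover have "\<phi> (\<tau>, \<rho>) = (\<tau> \<circ> Transposition.transpose i j, swap_at v i j \<rho>)"
      by (simp add: \<phi>_def pair vertex)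
    then have "\<phi> (\<tau>, \<rho>) = x"
      using swap_at_twice[OF vis(2,1)] by (simp add: x \<tau>_def \<rho>_def fun_eq_iff)
    moreover have "sign \<tau> = - (sign \<sigma> :: int)"
    proof -
      have "permutation \<sigma>"
        unfolding permutation_permutes using \<sigma> I by blast
      then show ?thesis
        using vis(1) by (simp add: \<tau>_def sign_compose sign_swap_id permutation_swap_id)
    qed
    ultimately show ?thesis
      using \<tau> \<rho> unfolding \<phi>x by (simp add: x)
  qed
  show ?thesis
    by (rule sum_eq_0_by_sign_reversing_involution[of ?S \<phi> ?f, OF key[THEN conjunct1]
          key[THEN conjunct2, THEN conjunct1] key[THEN conjunct2, THEN conjunct2]])
qed

text \<open>
  The determinant expands into a signed count of all families, whose intersecting part vanishes.
\<close>

theorem lindstroem_gessel_viennot: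
  assumes acyclic: "\<And>w. successively E w \<Longrightarrow> distinct w"
    and fin: "\<And>i j. i < n \<Longrightarrow> j < n \<Longrightarrow> finite (paths E (A i) (B j))"
  shows "det (mat n n (\<lambda>(i, j). int (card (paths E (A i) (B j))))) =
    (\<Sum>\<sigma> | \<sigma> permutes {0..<n}. sign \<sigma> *
       int (card {\<pi> \<in> families E A B {0..<n} \<sigma>. disjoint_family_on (\<lambda>k. set (\<pi> k)) {0..<n}}))"
    (is "det ?M = (\<Sum>\<sigma> | _. sign \<sigma> * int (card (?D \<sigma>)))")
proof -
  let ?P = "{\<sigma>. \<sigma> permutes {0..<n}}"
  let ?N = "\<lambda>\<sigma>. {\<pi> \<in> families E A B {0..<n} \<sigma>. \<not> disjoint_family_on (\<lambda>k. set (\<pi> k)) {0..<n}}"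
  have finF: "finite (families E A B {0..<n} \<sigma>)" if "\<sigma> \<in> ?P" for \<sigma>
    unfolding families_def using that fin permutes_in_image[of \<sigma> "{0..<n}"]
    by (intro finite_PiE) auto
  have "det ?M = (\<Sum>\<sigma>\<in>?P. sign \<sigma> * (\<Prod>i=0..<n. int (card (paths E (A i) (B (\<sigma> i))))))"
    unfolding det_def using permutes_in_image[of _ "{0..<n}"]
    by (auto simp: intro!: sum.cong prod.cong)
  also have "\<dots> = (\<Sum>\<sigma>\<in>?P. sign \<sigma> * int (card (families E A B {0..<n} \<sigma>)))"
    by (simp add: families_def card_PiE)
  also have "\<dots> = (\<Sum>\<sigma>\<in>?P. sign \<sigma> * int (card (?D \<sigma>)) + (\<Sum>\<pi>\<in>?N \<sigma>. sign \<sigma>))"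
  proof (rule sum.cong)
    fix \<sigma> assume "\<sigma> \<in> ?P"
    note f = finF[OF this]
    have "card (families E A B {0..<n} \<sigma>) = card (?D \<sigma> \<union> ?N \<sigma>)"
      by (rule arg_cong[of _ _ card]) auto
    also have "\<dots> = card (?D \<sigma>) + card (?N \<sigma>)"
      using f by (intro card_Un_disjoint) auto
    finally show "sign \<sigma> * int (card (families E A B {0..<n} \<sigma>))
        = sign \<sigma> * int (card (?D \<sigma>)) + (\<Sum>\<pi>\<in>?N \<sigma>. sign \<sigma>)"
      by (simp add: algebra_simps)
  qed simp
  also have "\<dots> = (\<Sum>\<sigma>\<in>?P. sign \<sigma> * int (card (?D \<sigma>))) + (\<Sum>\<sigma>\<in>?P. \<Sum>\<pi>\<in>?N \<sigma>. sign \<sigma>)"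
    by (rule sum.distrib)
  also have "(\<Sum>\<sigma>\<in>?P. \<Sum>\<pi>\<in>?N \<sigma>. sign \<sigma>) = (\<Sum>(\<sigma>, \<pi>)\<in>Sigma ?P ?N. sign \<sigma> :: int)"
    using finF by (intro sum.Sigma) (auto simp: finite_permutations)
  also have "\<dots> = 0"
    by (rule signed_sum_over_intersecting_families[OF acyclic]) auto
  finally show ?thesis
    by simp
qed

corollary lindstroem_gessel_viennot_nonpermutable:
  assumes acyclic: "\<And>w. successively E w \<Longrightarrow> distinct w"
    and fin: "\<And>i j. i < n \<Longrightarrow> j < n \<Longrightarrow> finite (paths E (A i) (B j))"
    and id_only: "\<And>\<sigma> \<pi>. \<sigma> permutes {0..<n} \<Longrightarrow> \<pi> \<in> families E A B {0..<n} \<sigma> \<Longrightarrow>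
      disjoint_family_on (\<lambda>k. set (\<pi> k)) {0..<n} \<Longrightarrow> \<sigma> = id"
  shows "det (mat n n (\<lambda>(i, j). int (card (paths E (A i) (B j))))) =
    int (card {\<pi> \<in> families E A B {0..<n} id. disjoint_family_on (\<lambda>k. set (\<pi> k)) {0..<n}})"
proof -
  let ?D = "\<lambda>\<sigma>. {\<pi> \<in> families E A B {0..<n} \<sigma>. disjoint_family_on (\<lambda>k. set (\<pi> k)) {0..<n}}"
  have "card (?D \<sigma>) = 0" if "\<sigma> permutes {0..<n}" "\<sigma> \<noteq> id" for \<sigma>
  proof -
    have "?D \<sigma> = {}"
      using id_only that by blast
    then show ?thesis
      by (simp only: card.empty)
  qed
  then have "(\<Sum>\<sigma> | \<sigma> permutes {0..<n}. sign \<sigma> * int (card (?D \<sigma>)))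
      = (\<Sum>\<sigma>\<in>{id}. sign \<sigma> * int (card (?D \<sigma>)))"
    by (intro sum.mono_neutral_right) (simp_all add: finite_permutations permutes_id)
  then show ?thesis
    by (simp add: lindstroem_gessel_viennot[OF acyclic fin] sign_id)
qed

section \<open>Schroeder paths as walks in a graph\<close>

text \<open>
  Attaching the constraint of staying weakly above the axis to the single steps turns Schroeder paths
  into the walks of a directed graph.
\<close>

definition large_step :: "int \<times> int \<Rightarrow> int \<times> int \<Rightarrow> bool" where
  "large_step p q \<longleftrightarrow> is_step p q \<and> snd p \<ge> 0 \<and> snd q \<ge> 0"

definition small_step :: "int \<times> int \<Rightarrow> int \<times> int \<Rightarrow> bool" where
  "small_step p q \<longleftrightarrow> large_step p q \<and> \<not> is_axis_level_step p q"

lemma successively_conj: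
  "successively (\<lambda>x y. P x y \<and> Q x y) w \<longleftrightarrow> successively P w \<and> successively Q w"
  by (induction w) (auto simp: successively_Cons)

lemma large_paths_eq_paths: "large_paths a b = paths large_step (a, 0) (b, 0)"
proof -
  have "successively is_step w \<and> (\<forall>p\<in>set w. snd p \<ge> 0) \<longleftrightarrow> successively large_step w"
    if "w \<noteq> []" "snd (hd w) \<ge> 0" for w
    using that
  proof (induction w)
    case (Cons p w)
    show ?case
    proof (cases "w = []")
      case False
      then have "snd (hd w) \<ge> 0 \<longleftrightarrow> 0 \<le> snd (hd w) \<and> hd w \<in> set w"
        by simp
      with Cons False show ?thesis
        unfolding successively_Cons large_step_def[of p] by auto
    qed (use Cons in simp)
  qed simp
  then show ?thesis
    unfolding large_paths_def paths_def by (intro Collect_cong) (metis snd_conv order_refl)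
qed

lemma small_paths_eq_paths: "small_paths a b = paths small_step (a, 0) (b, 0)"
  by (auto simp: small_paths_def large_paths_eq_paths paths_def small_step_def[abs_def]
      successively_conj)

lemma small_paths_subset: "small_paths a b \<subseteq> large_paths a b"
  by (auto simp: small_paths_def)

lemma is_step_iff:
  "is_step (x, y) (x', y') \<longleftrightarrow>
     x' = x + 1 \<and> y' = y + 1 \<or> x' = x + 1 \<and> y' = y - 1 \<or> x' = x + 2 \<and> y' = y"
  by (auto simp: is_step_def)

text \<open>
  Each step satisfies this relation, and the relation is transitive.
\<close>

lemma is_step_slope:
  assumes "successively is_step w"
  shows "sorted_wrt (\<lambda>p q. fst p < fst q \<and> \<bar>snd q - snd p\<bar> \<le> fst q - fst p \<and>
           even (fst q + snd q - (fst p + snd p))) w"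
    (is "sorted_wrt ?R w")
proof -
  have "successively ?R w"
    using assms by (rule successively_mono) (auto simp: is_step_iff)
  moreover have "transp ?R"
    by (rule transpI) auto
  ultimately show ?thesis
    by (simp add: successively_conv_sorted_wrt)
qed

lemma is_step_distinct_abscissae:
  assumes "successively is_step w"
  shows "distinct (map fst w)"
proof -
  have "sorted_wrt (<) (map fst w)"
    unfolding sorted_wrt_map
    by (rule sorted_wrt_mono_rel[OF _ is_step_slope[OF assms]]) simp
  then show ?thesis
    by (simp add: strict_sorted_iff)
qed

lemma successively_large_stepD: "successively large_step w \<Longrightarrow> successively is_step w"
  by (erule successively_mono) (simp add: large_step_def)

lemma successively_small_stepD: "successively small_step w \<Longrightarrow> successively large_step w"
  by (erule successively_mono) (simp add: small_step_def)

text \<open>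
  A path can rise or fall by at most one unit per unit of width, which confines it to the triangle
  over its end points; the parity of \<open>x + y\<close> is constant along it.
\<close>

lemma large_path_vertex_bounds:
  assumes w: "w \<in> large_paths a b" and v: "(x, y) \<in> set w"
  shows "a \<le> x" "x \<le> b" "0 \<le> y" "y \<le> x - a" "y \<le> b - x" "even (x + y - a)"
proof -
  note slope = is_step_slope[of w]
  obtain p s where ps: "w = p @ (x, y) # s"
    using v split_list by metis
  have l: "p = [] \<and> x = a \<and> y = 0 \<or> a < x \<and> y \<le> x - a \<and> even (x + y - a)"
    using slope w by (cases p) (auto simp: ps large_paths_def)
  have r: "s = [] \<and> x = b \<and> y = 0 \<or> x < b \<and> y \<le> b - x"
    using slope w by (cases s rule: rev_cases) (auto simp: ps large_paths_def sorted_wrt_append)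
  show "a \<le> x" "x \<le> b" "0 \<le> y" "y \<le> x - a" "y \<le> b - x" "even (x + y - a)"
    using l r w v by (auto simp: large_paths_def)
qed

lemma large_path_vertex_unique:
  assumes w: "w \<in> large_paths a b" and "(x, y) \<in> set w" "(x, y') \<in> set w"
  shows "y = y'"
proof -
  have "inj_on fst (set w)"
    using is_step_distinct_abscissae[of w] w by (auto simp: large_paths_def distinct_map)
  from inj_onD[OF this _ assms(2,3)] show ?thesis
    by simp
qed

lemma finite_large_paths: "finite (large_paths a b)"
proof (rule finite_subset)
  show "large_paths a b \<subseteq> {w. set w \<subseteq> {a..b} \<times> {0..b - a} \<and> distinct w}"
  proof clarify
    fix w assume w: "w \<in> large_paths a b"
    have "x \<in> {a..b} \<and> y \<in> {0..b - a}" if "(x, y) \<in> set w" for x y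
      using large_path_vertex_bounds[OF w that] by auto
    moreover have "distinct w"
      using w is_step_distinct_abscissae[of w] by (simp add: large_paths_def distinct_map)
    ultimately show "set w \<subseteq> {a..b} \<times> {0..b - a} \<and> distinct w"
      by auto
  qed
  show "finite {w. set w \<subseteq> {a..b} \<times> {0..b - a} \<and> distinct w}"
    by (rule finite_subset_distinct) auto
qed

lemma finite_small_paths: "finite (small_paths a b)"
  using finite_subset[OF small_paths_subset finite_large_paths] .

section \<open>Horizontal translation\<close>

definition translate :: "int \<Rightarrow> int \<Rightarrow> int \<times> int \<Rightarrow> int \<times> int" where
  "translate c d = (\<lambda>(x, y). (x + c, y + d))"

lemma translate_simp [simp]: "translate c d (x, y) = (x + c, y + d)"
  by (simp add: translate_def)

lemma fst_translate [simp]: "fst (translate c d p) = fst p + c"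
  and snd_translate [simp]: "snd (translate c d p) = snd p + d"
  by (simp_all add: translate_def split_beta)

lemma is_step_translate_iff [simp]: "is_step (translate c d p) (translate c d q) \<longleftrightarrow> is_step p q"
  by (simp add: is_step_def)

lemma translate_translate [simp]: "translate c d (translate c' d' p) = translate (c + c') (d + d') p"
  by (cases p) simp

lemma translate_0_0 [simp]: "translate 0 0 p = p"
  by (cases p) simp

lemma map_translate_large_paths: "w \<in> large_paths a b \<Longrightarrow> map (translate c 0) w \<in> large_paths (a + c) (b + c)"
  by (auto simp: large_paths_def hd_map last_map successively_map)

lemma map_translate_small_paths: "w \<in> small_paths a b \<Longrightarrow> map (translate c 0) w \<in> small_paths (a + c) (b + c)"
  by (auto simp: small_paths_def map_translate_large_paths successively_map is_axis_level_step_def)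

lemma card_large_paths: "card (large_paths a (a + 2 * int n)) = large_schroeder n"
proof -
  have "bij_betw (map (translate (- a) 0)) (large_paths a (a + 2 * int n)) (large_paths 0 (2 * int n))"
    using map_translate_large_paths[of _ a "a + 2 * int n" "- a"]
      map_translate_large_paths[of _ 0 "2 * int n" a]
    by (intro bij_betw_byWitness[of _ "map (translate a 0)"]) (auto simp: comp_def add.commute)
  then show ?thesis
    by (simp add: large_schroeder_def bij_betw_same_card)
qed

lemma card_small_paths:
  assumes "n > 0"
  shows "card (small_paths a (a + 2 * int n)) = small_schroeder n"
proof -
  have "bij_betw (map (translate (- a) 0)) (small_paths a (a + 2 * int n)) (small_paths 0 (2 * int n))"
    using map_translate_small_paths[of _ a "a + 2 * int n" "- a"]
      map_translate_small_paths[of _ 0 "2 * int n" a]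
    by (intro bij_betw_byWitness[of _ "map (translate a 0)"]) (auto simp: comp_def add.commute)
  then show ?thesis
    using assms by (simp add: small_schroeder_def bij_betw_same_card)
qed

section \<open>Crossing paths\<close>

text \<open>
  The height of a path over the abscissa \<open>x\<close> is the ordinate of its last vertex not to the right
  of \<open>x\<close>. Over the midpoint of a level step this is the ordinate of the curve, and the height changes
  by at most \<open>1\<close> per unit.
\<close>

fun height :: "path \<Rightarrow> int \<Rightarrow> int" where
  "height [] x = 0"
| "height [p] x = snd p"
| "height (p # q # w) x = (if fst q \<le> x then height (q # w) x else snd p)"

lemma height_cases:
  assumes "successively is_step w" "w \<noteq> []" "fst (hd w) \<le> x" "x \<le> fst (last w)"
  shows "(x, height w x) \<in> set w \<or> (x - 1, height w x) \<in> set w \<and> (x + 1, height w x) \<in> set w"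
  using assms
proof (induction w x rule: height.induct)
  case (3 p q w x)
  obtain px py qx qy where pq: "p = (px, py)" "q = (qx, qy)"
    by fastforce
  show ?case
  proof (cases "qx \<le> x")
    case True
    with 3 show ?thesis
      by (auto simp: pq)
  next
    case False
    moreover have "is_step p q"
      using 3 by simp
    ultimately consider "x = px" | "px = x - 1" "qx = x + 1" "qy = py"
      using 3 by (fastforce simp: pq is_step_iff)
    then show ?thesis
      using False by cases (auto simp: pq)
  qed
qed auto

lemma height_step:
  assumes "successively is_step w" "w \<noteq> []" "fst (hd w) \<le> x" "x < fst (last w)"
  shows "height w (x + 1) = height w x \<or>
    \<bar>height w (x + 1) - height w x\<bar> = 1 \<and> (x, height w x) \<in> set w"
  using assms
proof (induction w x rule: height.induct)
  case (3 p q w x)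
  obtain px py qx qy where pq: "p = (px, py)" "q = (qx, qy)"
    by fastforce
  have st: "is_step p q" and sorted: "\<forall>r \<in> set w. qx < fst r"
    using 3 is_step_slope[of "p # q # w"] by (auto simp: pq)
  have hq: "height (q # w) qx = qy"
    using sorted by (cases w) (auto simp: pq)
  show ?case
  proof (cases "qx \<le> x")
    case True
    with 3 show ?thesis
      by (auto simp: pq)
  next
    case False
    then show ?thesis
      using st hq 3 by (cases "x + 1 = qx") (auto simp: pq is_step_iff)
  qed
qed auto

text \<open>
  A discrete intermediate value theorem. The height difference of the paths is nonnegative over \<open>c\<close>
  and nonpositive over \<open>b\<close>, and it changes by at most \<open>2\<close> per unit. It cannot jump
  from \<open>1\<close> to \<open>-1\<close>, since then both paths would have a vertex at the same abscissa with ordinates of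
  different parity. So the heights agree somewhere, and parity decides whether both paths have a vertex
  there or both are in the middle of the same level step.
\<close>

lemma large_paths_cross:
  assumes w: "w \<in> large_paths a b" and u: "u \<in> large_paths c d"
    and order: "a \<le> c" "c \<le> b" "b \<le> d" and parity: "even (a - c)"
  shows "set w \<inter> set u \<noteq> {}"
proof -
  have W: "successively is_step w" "w \<noteq> []" "hd w = (a, 0)" "last w = (b, 0)"
    and U: "successively is_step u" "u \<noteq> []" "hd u = (c, 0)" "last u = (d, 0)"
    using w u by (auto simp: large_paths_def)
  have cw: "(x, height w x) \<in> set w \<or> (x - 1, height w x) \<in> set w \<and> (x + 1, height w x) \<in> set w"
    if "c \<le> x" "x \<le> b" for x
    using height_cases[of w x] W that order by simp
  have cu: "(x, height u x) \<in> set u \<or> (x - 1, height u x) \<in> set u \<and> (x + 1, height u x) \<in> set u"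
    if "c \<le> x" "x \<le> b" for x
    using height_cases[of u x] U that order by simp
  have "\<exists>x. c \<le> x \<and> x \<le> b \<and> height w x = height u x"
  proof (rule ccontr)
    assume contra: "\<nexists>x. c \<le> x \<and> x \<le> b \<and> height w x = height u x"
    have "x \<le> b \<longrightarrow> height u x < height w x" if "c \<le> x" for x
      using that
    proof (induction x rule: int_ge_induct)
      case base
      have "(c - 1, y) \<notin> set u" for y
        using large_path_vertex_bounds(1)[OF u, of "c - 1" y] by auto
      then have "(c, height u c) \<in> set u"
        using cu[of c] order by auto
      moreover have "(c, 0) \<in> set u"
        using U hd_in_set by metis
      ultimately have "height u c = 0"
        using large_path_vertex_unique[OF u] by blast
      moreover have "height w c \<ge> 0"
        using cw[of c] order large_path_vertex_bounds(3)[OF w] by blast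
      ultimately show ?case
        using contra order by force
    next
      case (step x)
      show ?case
      proof (intro impI, rule ccontr)
        assume x: "x + 1 \<le> b" and "\<not> height u (x + 1) < height w (x + 1)"
        with contra step have less: "height w (x + 1) < height u (x + 1)"
          using linorder_cases[of "height w (x + 1)" "height u (x + 1)"] by fastforce
        have "height u x < height w x"
          using step x by simp
        \<comment> \<open>A sign change needs both heights to move, so both paths have a vertex over x.\<close>
        with less height_step[of w x] height_step[of u x] W U step x order
        have "height w x = height u x + 1" "(x, height w x) \<in> set w" "(x, height u x) \<in> set u"
          by auto
        then show False
          using large_path_vertex_bounds(6)[OF w, of x "height w x"]
            large_path_vertex_bounds(6)[OF u, of x "height u x"] parity
          by presburger
      qed
    qed
    then have "height u b < height w b"
      using order by simp
    moreover have "(b + 1, y) \<notin> set w" for y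
      using large_path_vertex_bounds(2)[OF w, of "b + 1" y] by auto
    then have "(b, height w b) \<in> set w"
      using cw[of b] order by auto
    moreover have "(b, 0) \<in> set w"
      using W last_in_set by metis
    ultimately have "height u b < 0"
      using large_path_vertex_unique[OF w] by metis
    moreover have "height u b \<ge> 0"
      using cu[of b] order large_path_vertex_bounds(3)[OF u] by blast
    ultimately show False
      by simp
  qed
  then obtain x where x: "c \<le> x" "x \<le> b" "height w x = height u x"
    by blast
  note cases = cw[OF x(1,2)] cu[OF x(1,2)]
  show ?thesis
  proof (cases "even (x + height w x - a)")
    case True
    have "(x, height w x) \<in> set w" "(x, height u x) \<in> set u"
      using cases True parity x(3) large_path_vertex_bounds(6)[OF w, of "x - 1" "height w x"]
        large_path_vertex_bounds(6)[OF u, of "x - 1" "height u x"]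
      by (auto; presburger)+
    then show ?thesis
      using x by auto
  next
    case False
    have "(x - 1, height w x) \<in> set w" "(x - 1, height u x) \<in> set u"
      using cases False parity x(3) large_path_vertex_bounds(6)[OF w, of "x" "height w x"]
        large_path_vertex_bounds(6)[OF u, of "x" "height u x"]
      by (auto; presburger)+
    then show ?thesis
      using x by auto
  qed
qed

section \<open>Large paths are twice as many as small ones\<close>

text \<open>
  A pair \<open>(P, Q)\<close> of this set codes two different paths. Concatenating the vertex lists of \<open>P\<close> and \<open>Q\<close>
  inserts a level step on the axis between them, and it is the last such step because \<open>Q\<close> is small.
  Raising \<open>P\<close> to the height \<open>1\<close> between an up and a down step, followed by \<open>Q\<close>, gives a small path.
  Both codings are bijective if \<open>a < b\<close>, so the large paths that are not small are as many as the small ones.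
\<close>

definition level_splits :: "int \<Rightarrow> int \<Rightarrow> (path \<times> path) set" where
  "level_splits a b = {(P, Q). \<exists>c. P \<in> large_paths a c \<and> Q \<in> small_paths (c + 2) b}"

lemma last_violation:
  assumes "\<not> successively R w"
  obtains P Q where "w = P @ Q" "P \<noteq> []" "Q \<noteq> []" "\<not> R (last P) (hd Q)" "successively R Q"
proof -
  have "\<exists>P Q. w = P @ Q \<and> P \<noteq> [] \<and> Q \<noteq> [] \<and> \<not> R (last P) (hd Q) \<and> successively R Q"
    using assms
  proof (induction w)
    case (Cons p w)
    show ?case
    proof (cases "successively R w")
      case True
      with Cons.prems have "w \<noteq> []" "\<not> R p (hd w)"
        by (auto simp: successively_Cons)
      with True show ?thesis
        by (intro exI[of _ "[p]"] exI[of _ w]) simp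
    next
      case False
      then obtain P Q where "w = P @ Q \<and> P \<noteq> [] \<and> Q \<noteq> [] \<and> \<not> R (last P) (hd Q) \<and> successively R Q"
        using Cons.IH by blast
      then show ?thesis
        by (intro exI[of _ "p # P"] exI[of _ Q]) simp
    qed
  qed simp
  then show ?thesis
    using that by blast
qed

lemma bij_betw_insert_level:
  "bij_betw (\<lambda>(P, Q). P @ Q) (level_splits a b) (large_paths a b - small_paths a b)"
  unfolding bij_betw_def
proof
  \<comment> \<open>The level step between P and Q cannot be inside a small path, so the cut is determined.\<close>
  have unique: "us = []"
    if "P \<in> large_paths a c" "Q \<in> small_paths (c + 2) b" "P = P' @ us" "us @ Q \<in> small_paths d b"
    for P P' Q us c d
  proof (rule ccontr)
    assume "us \<noteq> []"
    then have "last us = (c, 0)" "hd Q = (c + 2, 0)" "Q \<noteq> []"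
      using that(1,2,3) by (simp_all add: small_paths_def large_paths_def)
    then show False
      using that(4) \<open>us \<noteq> []\<close>
      by (simp add: small_paths_def successively_append_iff is_axis_level_step_def)
  qed
  show "inj_on (\<lambda>(P, Q). P @ Q) (level_splits a b)"
  proof (rule inj_onI, clarify)
    fix P Q P' Q'
    assume "(P, Q) \<in> level_splits a b" "(P', Q') \<in> level_splits a b" and eq: "P @ Q = P' @ Q'"
    then obtain c d where c: "P \<in> large_paths a c" "Q \<in> small_paths (c + 2) b"
      and d: "P' \<in> large_paths a d" "Q' \<in> small_paths (d + 2) b"
      by (auto simp: level_splits_def)
    from eq obtain us where "P = P' @ us \<and> us @ Q = Q' \<or> P @ us = P' \<and> Q = us @ Q'"
      unfolding append_eq_append_conv2 by blast
    then show "P = P' \<and> Q = Q'"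
    proof
      assume us: "P = P' @ us \<and> us @ Q = Q'"
      then have "us = []"
        using unique[OF c, of P' us "d + 2"] d(2) by simp
      with us show ?thesis
        by simp
    next
      assume us: "P @ us = P' \<and> Q = us @ Q'"
      then have "us = []"
        using unique[OF d, of P us "c + 2"] c(2) by simp
      with us show ?thesis
        by simp
    qed
  qed
  show "(\<lambda>(P, Q). P @ Q) ` level_splits a b = large_paths a b - small_paths a b"
  proof (intro equalityI subsetI)
    fix w assume "w \<in> (\<lambda>(P, Q). P @ Q) ` level_splits a b"
    then obtain P Q c where "P \<in> large_paths a c" "Q \<in> small_paths (c + 2) b" "w = P @ Q"
      by (auto simp: level_splits_def)
    then show "w \<in> large_paths a b - small_paths a b"
      by (simp add: small_paths_def large_paths_def successively_append_iff
          is_axis_level_step_def is_step_iff ball_Un)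
  next
    fix w assume w: "w \<in> large_paths a b - small_paths a b"
    then have "\<not> successively (\<lambda>p q. \<not> is_axis_level_step p q) w"
      by (auto simp: small_paths_def)
    then obtain P Q where PQ: "w = P @ Q" "P \<noteq> []" "Q \<noteq> []" "is_axis_level_step (last P) (hd Q)"
      "successively (\<lambda>p q. \<not> is_axis_level_step p q) Q"
      by (rule last_violation) auto
    define c where "c = fst (last P)"
    have "last P = (c, 0)" "hd Q = (c + 2, 0)"
      using PQ(4) by (auto simp: c_def is_axis_level_step_def prod_eq_iff)
    with PQ w have "(P, Q) \<in> level_splits a b"
      by (auto simp: level_splits_def small_paths_def large_paths_def successively_append_iff)
    then show "w \<in> (\<lambda>(P, Q). P @ Q) ` level_splits a b"
      by (rule rev_image_eqI) (simp add: PQ(1))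
  qed
qed

lemma no_axis_level_step_above_axis:
  "\<forall>p\<in>set w. snd p > 0 \<Longrightarrow> successively (\<lambda>p q. \<not> is_axis_level_step p q) w"
  by (induction w) (auto simp: successively_Cons is_axis_level_step_def)

lemma small_path_first_step:
  assumes "w \<in> small_paths a b" "a < b"
  obtains t where "w = (a, 0) # (a + 1, 1) # t"
proof -
  obtain t where t: "w = (a, 0) # t"
    using assms by (cases w) (auto simp: small_paths_def large_paths_def)
  obtain p s where p: "t = p # s"
    using assms t by (cases t) (auto simp: small_paths_def large_paths_def)
  have "p = (a + 1, 1)"
    using assms(1) by (cases p) (auto simp: t p small_paths_def large_paths_def is_step_iff
        is_axis_level_step_def)
  then show ?thesis
    using that t p by simp
qed

lemma small_path_last_step:
  assumes "w \<in> small_paths a b" "a < b"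
  obtains s where "w = s @ [(b - 1, 1), (b, 0)]"
proof -
  obtain t where t: "w = t @ [(b, 0)]"
    using assms by (cases w rule: rev_cases) (auto simp: small_paths_def large_paths_def)
  obtain p s where p: "t = s @ [p]"
    using assms t by (cases t rule: rev_cases) (auto simp: small_paths_def large_paths_def)
  have "p = (b - 1, 1)"
    using assms(1) by (cases p) (auto simp: t p small_paths_def large_paths_def is_step_iff
        is_axis_level_step_def successively_append_iff)
  then show ?thesis
    using that t p by simp
qed

lemma bij_betw_raise_prefix:
  assumes "a < b"
  shows "bij_betw (\<lambda>(P, Q). (a, 0) # map (translate 1 1) P @ Q) (level_splits a b) (small_paths a b)"
    (is "bij_betw ?g _ _")
  unfolding bij_betw_def
proof
  \<comment> \<open>The raised part stays above the axis, where Q starts, so the cut is determined.\<close>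
  have unique: "us = []"
    if "P \<in> large_paths a c" "Q \<in> small_paths d b" "map (translate 1 1) P = M @ us" "Q = us @ S"
    for P Q M S us c d
  proof (rule ccontr)
    assume "us \<noteq> []"
    then have "hd us \<in> set (map (translate 1 1) P)" "hd us = hd Q"
      using that(3,4) by simp_all
    with that(1,2) show False
      by (auto simp: large_paths_def small_paths_def)
  qed
  have inj_map: "P = P'" if "map (translate 1 1) P = map (translate 1 1) P'" for P P'
  proof -
    have "inj (translate 1 1)"
      by (rule injI) (auto simp: prod_eq_iff dest: arg_cong[of _ _ fst] arg_cong[of _ _ snd])
    then show ?thesis
      using that by simp
  qed
  show "inj_on ?g (level_splits a b)"
  proof (rule inj_onI, clarify)
    fix P Q P' Q'
    assume "(P, Q) \<in> level_splits a b" "(P', Q') \<in> level_splits a b"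
      and eq: "map (translate 1 1) P @ Q = map (translate 1 1) P' @ Q'"
    then obtain c d where c: "P \<in> large_paths a c" "Q \<in> small_paths (c + 2) b"
      and d: "P' \<in> large_paths a d" "Q' \<in> small_paths (d + 2) b"
      by (auto simp: level_splits_def)
    from eq obtain us where us: "map (translate 1 1) P = map (translate 1 1) P' @ us \<and> us @ Q = Q' \<or>
        map (translate 1 1) P @ us = map (translate 1 1) P' \<and> Q = us @ Q'"
      unfolding append_eq_append_conv2 by blast
    then have "us = []"
      using unique[OF c(1) d(2), of _ us] unique[OF d(1) c(2), of _ us] by metis
    with us show "P = P' \<and> Q = Q'"
      using inj_map by auto
  qed
  show "?g ` level_splits a b = small_paths a b"
  proof (intro equalityI subsetI)
    fix w assume "w \<in> ?g ` level_splits a b"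
    then obtain P Q c where P: "P \<in> large_paths a c" and Q: "Q \<in> small_paths (c + 2) b"
      and w: "w = (a, 0) # map (translate 1 1) P @ Q"
      by (auto simp: level_splits_def)
    have "successively (\<lambda>p q. \<not> is_axis_level_step p q) (map (translate 1 1) P)"
      using P by (intro no_axis_level_step_above_axis) (auto simp: large_paths_def)
    moreover have "successively is_step (map (translate 1 1) P)"
      using P by (simp add: large_paths_def successively_map)
    ultimately show "w \<in> small_paths a b"
      using P Q by (auto simp: w large_paths_def small_paths_def successively_append_iff
          successively_Cons hd_map last_map is_step_iff is_axis_level_step_def)
  next
    fix w assume w: "w \<in> small_paths a b"
    then obtain t' where t': "w = (a, 0) # (a + 1, 1) # t'"
      using assms by (rule small_path_first_step)
    define t where "t = (a + 1, 1 :: int) # t'"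
    \<comment> \<open>The raised part ends just before the first return of the path to the axis.\<close>
    define M Q where "M = takeWhile (\<lambda>p. snd p > 0) t" and "Q = dropWhile (\<lambda>p. snd p > 0) t"
    have t: "w = (a, 0) # t" "t = M @ Q"
      by (simp_all add: t' t_def M_def Q_def)
    have M: "M \<noteq> []" "hd M = (a + 1, 1)" "\<forall>p\<in>set M. snd p > 0"
      by (auto simp: M_def t_def dest: set_takeWhileD)
    have "last t = (b, 0)"
      using w by (simp add: t' t_def small_paths_def large_paths_def)
    then have "\<not> (\<forall>p\<in>set t. snd p > 0)"
      by (metis last_in_set t_def list.distinct(1) snd_conv less_irrefl)
    then have Q0: "Q \<noteq> []"
      by (auto simp: Q_def dropWhile_eq_Nil_conv)
    then have "\<not> snd (hd Q) > 0"
      unfolding Q_def by (rule hd_dropWhile)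
    moreover have "snd (hd Q) \<ge> 0"
      using w Q0 by (simp add: t small_paths_def large_paths_def)
    ultimately have "snd (hd Q) = 0"
      by simp
    moreover have "is_step (last M) (hd Q)"
      using w M(1) Q0
      by (simp add: t small_paths_def large_paths_def successively_append_iff successively_Cons)
    moreover have "snd (last M) > 0"
      using M by simp
    moreover define c where "c = fst (last M) - 1"
    ultimately have c: "last M = (c + 1, 1)" "hd Q = (c + 2, 0)"
      by (auto simp: is_step_def prod_eq_iff)
    have "map (translate (- 1) (- 1)) M \<in> large_paths a c"
      using w M c(1)
      by (auto simp: t large_paths_def small_paths_def successively_map hd_map last_map
          successively_append_iff successively_Cons)
    moreover have "Q \<in> small_paths (c + 2) b"
      using w Q0 c(2)
      by (auto simp: t large_paths_def small_paths_def successively_append_iff successively_Cons)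
    ultimately have "(map (translate (- 1) (- 1)) M, Q) \<in> level_splits a b"
      by (auto simp: level_splits_def)
    then show "w \<in> ?g ` level_splits a b"
      by (rule rev_image_eqI) (simp add: t comp_def)
  qed
qed

lemma card_large_paths_eq_twice_small:
  assumes "a < b"
  shows "card (large_paths a b) = 2 * card (small_paths a b)"
proof -
  have "card (large_paths a b - small_paths a b) = card (small_paths a b)"
    using bij_betw_same_card[OF bij_betw_insert_level] bij_betw_same_card[OF bij_betw_raise_prefix[OF assms]]
    by metis
  moreover have "card (large_paths a b - small_paths a b) + card (small_paths a b) = card (large_paths a b)"
    using card_Diff_subset[OF finite_small_paths small_paths_subset, of a b]
      card_mono[OF finite_large_paths small_paths_subset, of a b] by simp
  ultimately show ?thesis
    by simp
qed

corollary large_schroeder_eq_twice_small: "n > 0 \<Longrightarrow> large_schroeder n = 2 * small_schroeder n"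
  by (simp add: large_schroeder_def small_schroeder_def card_large_paths_eq_twice_small)

section \<open>Small families and large families with one path less\<close>

text \<open>
  Written in steps, \<open>lift_path i w\<close> is \<open>UUwDD\<close>: a path that belongs to index \<open>i - 1\<close> is raised by two
  units and gets the end points that belong to index \<open>i\<close>.
\<close>

definition lift_path :: "int \<Rightarrow> path \<Rightarrow> path" where
  "lift_path i w = (- 2 * i + 1, 0) # (- 2 * i + 2, 1) # map (translate 0 2) w
     @ [(2 * i - 2, 1), (2 * i - 1, 0)]"

lemma inj_lift_path: "inj (lift_path i)"
proof (rule injI)
  fix w w' assume "lift_path i w = lift_path i w'"
  then have "map (translate 0 2) w = map (translate 0 2) w'"
    by (simp add: lift_path_def)
  then have "map (translate 0 (- 2)) (map (translate 0 2) w)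
      = map (translate 0 (- 2)) (map (translate 0 2) w')"
    by (rule arg_cong)
  then show "w = w'"
    by (simp add: comp_def)
qed

lemma is_axis_level_step_iff:
  "is_axis_level_step (x, y) (x', y') \<longleftrightarrow> x' = x + 2 \<and> y = 0 \<and> y' = 0"
  by (auto simp: is_axis_level_step_def)

lemma lift_path_small:
  assumes "w \<in> large_paths (- 2 * i + 3) (2 * i - 3)"
  shows "lift_path i w \<in> small_paths (- 2 * i + 1) (2 * i - 1)"
proof -
  let ?m = "map (translate 0 2) w"
  have w: "w \<noteq> []" "hd w = (- 2 * i + 3, 0)" "last w = (2 * i - 3, 0)" "successively is_step w"
    "\<forall>p\<in>set w. snd p \<ge> 0"
    using assms by (auto simp: large_paths_def)
  have m: "?m \<noteq> []" "hd ?m = (- 2 * i + 3, 2)" "last ?m = (2 * i - 3, 2)" "successively is_step ?m"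
    using w by (simp_all add: hd_map last_map successively_map)
  have pos: "\<forall>p\<in>set ?m. snd p > 0"
    using w(5) by auto
  then have nn: "\<forall>p\<in>set ?m. snd p \<ge> 0"
    by (auto intro: less_imp_le)
  note level = no_axis_level_step_above_axis[OF pos]
  show ?thesis
    using m(1) unfolding lift_path_def small_paths_def large_paths_def
    by (simp add: m nn level successively_append_iff successively_Cons is_step_iff
        is_axis_level_step_iff del: set_map)
qed

text \<open>
  A small path leaves the axis with an up step. If its next step were level or down, it would visit a
  vertex of height at most \<open>1\<close> in the range where \<open>high\<close> excludes this. The same argument
  applies at the other end.
\<close>

lemma small_path_eq_lift_path:
  assumes w: "w \<in> small_paths (- 2 * i + 1) (2 * i - 1)" and i: "i \<ge> 2"
    and high: "\<And>x y. (x, y) \<in> set w \<Longrightarrow> \<bar>x\<bar> \<le> 2 * i - 3 \<Longrightarrow> y \<ge> 2"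
  shows "\<exists>w' \<in> large_paths (- 2 * i + 3) (2 * i - 3). w = lift_path i w'"
proof -
  have ab: "- 2 * i + 1 < 2 * i - 1"
    using i by simp
  obtain t where t: "w = (- 2 * i + 1, 0) # (- 2 * i + 2, 1) # t"
    using small_path_first_step[OF w ab] by (auto simp: algebra_simps)
  obtain s where s: "w = s @ [(2 * i - 2, 1), (2 * i - 1, 0)]"
    using small_path_last_step[OF w ab] by (auto simp: algebra_simps)
  have step: "successively is_step w"
    using w by (simp add: small_paths_def large_paths_def)
  obtain m where m: "w = (- 2 * i + 1, 0) # (- 2 * i + 2, 1) # m @ [(2 * i - 2, 1), (2 * i - 1, 0)]"
    using t s i by (cases s; cases "tl s") auto
  note slope = is_step_slope[OF step, unfolded m]
  have inner: "\<bar>x\<bar> \<le> 2 * i - 3 \<and> y \<ge> 2" if "(x, y) \<in> set m" for x y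
  proof -
    have "2 - 2 * i < x \<and> x < 2 * i - 2"
      using slope that by (fastforce simp: sorted_wrt_append)
    then have "\<bar>x\<bar> \<le> 2 * i - 3"
      by auto
    with high[of x y] that show ?thesis
      by (simp add: m)
  qed
  have "m \<noteq> []"
    using step i by (auto simp: m is_step_iff)
  then have hd: "hd m = (- 2 * i + 3, 2)" and last: "last m = (2 * i - 3, 2)"
    using step inner[of "fst (hd m)" "snd (hd m)"] inner[of "fst (last m)" "snd (last m)"]
    by (auto simp: m successively_append_iff successively_Cons is_step_def prod_eq_iff)
  define w' where "w' = map (translate 0 (- 2)) m"
  have "w' \<in> large_paths (- 2 * i + 3) (2 * i - 3)"
    using \<open>m \<noteq> []\<close> hd last step inner
    by (auto simp: w'_def m large_paths_def hd_map last_map successively_map successively_append_iff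
        successively_Cons)
  moreover have "w = lift_path i w'"
    by (simp add: m w'_def lift_path_def comp_def)
  ultimately show ?thesis
    by blast
qed

lemma small_paths_unit: "small_paths (- 1) 1 = {[(- 1, 0), (0, 1), (1, 0)]}"
proof (intro equalityI subsetI)
  fix w assume w: "w \<in> small_paths (- 1) 1"
  obtain t where t: "w = (- 1, 0) # (0, 1) # t"
    using small_path_first_step[OF w] by auto
  obtain s where s: "w = s @ [(0, 1), (1, 0)]"
    using small_path_last_step[OF w] by auto
  have "distinct (map fst w)"
    using w by (intro is_step_distinct_abscissae) (simp add: small_paths_def large_paths_def)
  then have "w = [(- 1, 0), (0, 1), (1, 0)]"
    using t s by (cases s; cases "tl s") auto
  then show "w \<in> {[(- 1, 0), (0, 1), (1, 0)]}"
    by simp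
qed (auto simp: small_paths_def large_paths_def is_step_iff is_axis_level_step_def)

lemma small_path_outer_vertices:
  assumes "w \<in> small_paths (- 2 * i + 1) (2 * i - 1)" "i \<ge> 1"
  shows "{(- 2 * i + 1, 0), (- 2 * i + 2, 1), (2 * i - 2, 1), (2 * i - 1, 0)} \<subseteq> set w"
proof -
  have ab: "- 2 * i + 1 < 2 * i - 1"
    using assms by simp
  obtain t where "w = (- 2 * i + 1, 0) # (- 2 * i + 2, 1) # t"
    using small_path_first_step[OF assms(1) ab] by (auto simp: algebra_simps)
  moreover obtain s where "w = s @ [(2 * i - 2, 1), (2 * i - 1, 0)]"
    using small_path_last_step[OF assms(1) ab] by (auto simp: algebra_simps)
  ultimately show ?thesis
    by (metis (no_types, lifting) Un_iff empty_subsetI insert_subset list.set_intros(1) list.set_intros(2) set_append)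
qed

definition lift_family :: "nat \<Rightarrow> (nat \<Rightarrow> path) \<Rightarrow> nat \<Rightarrow> path" where
  "lift_family n \<pi> = (\<lambda>i\<in>{1..Suc n}.
     if i = 1 then [(- 1, 0), (0, 1), (1, 0)] else lift_path (int i) (\<pi> (i - 1)))"

lemma lift_family_small:
  assumes "\<pi> \<in> large_families n"
  shows "lift_family n \<pi> \<in> small_families (Suc n)"
proof -
  have \<pi>: "\<pi> i \<in> large_paths (- 2 * int i + 1) (2 * int i - 1)" if "i \<in> {1..n}" for i
    using assms that by (auto simp: large_families_def PiE_iff)
  have disj: "set (\<pi> i) \<inter> set (\<pi> j) = {}" if "i \<in> {1..n}" "j \<in> {1..n}" "i \<noteq> j" for i j
    using assms that by (auto simp: large_families_def nonintersecting_def)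
  have "lift_family n \<pi> i \<in> small_paths (- 2 * int i + 1) (2 * int i - 1)" if "i \<in> {1..Suc n}" for i
  proof (cases "i = 1")
    case True
    then show ?thesis
      using that small_paths_unit by (simp add: lift_family_def)
  next
    case False
    with that have "i - 1 \<in> {1..n}"
      by auto
    from \<pi>[OF this] False that show ?thesis
      using lift_path_small[of "\<pi> (i - 1)" "int i"]
      by (simp add: lift_family_def of_nat_diff algebra_simps)
  qed
  moreover have "set (lift_family n \<pi> i) \<inter> set (lift_family n \<pi> j) = {}"
    if "i \<in> {1..Suc n}" "j \<in> {1..Suc n}" "i < j" for i j
  proof -
    define L where "L i = {(- 2 * int i + 1, 0), (- 2 * int i + 2, 1), (2 * int i - 2, 1), (2 * int i - 1, 0 :: int)}" for i
    define U where "U i = (if i = 1 then {} else translate 0 2 ` set (\<pi> (i - 1)))" for i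
    have set: "set (lift_family n \<pi> i) = L i \<union> U i" if "i \<in> {1..Suc n}" for i
      using that by (auto simp: lift_family_def lift_path_def L_def U_def)
    have "L i \<inter> L j = {}"
      using that by (auto simp: L_def)
    moreover have "y \<ge> 2" if k: "k \<in> {1..Suc n}" and "(x, y) \<in> U k" for x y k
    proof -
      from that obtain p where p: "p \<in> set (\<pi> (k - 1))" "y = snd p + 2" "k \<noteq> 1"
        by (auto simp: U_def prod_eq_iff split: if_splits)
      then have "\<pi> (k - 1) \<in> large_paths (- 2 * int (k - 1) + 1) (2 * int (k - 1) - 1)"
        using k by (intro \<pi>) auto
      then show ?thesis
        using p by (auto simp: large_paths_def)
    qed
    then have "L i \<inter> U j = {}" "U i \<inter> L j = {}"
      using that by (fastforce simp: L_def)+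
    moreover have "U i \<inter> U j = {}"
    proof -
      have "inj (translate 0 2)"
        by (rule injI) (auto simp: prod_eq_iff dest: arg_cong[of _ _ fst] arg_cong[of _ _ snd])
      moreover have "set (\<pi> (i - 1)) \<inter> set (\<pi> (j - 1)) = {}" if "i \<noteq> 1"
        using \<open>i \<in> {1..Suc n}\<close> \<open>j \<in> {1..Suc n}\<close> \<open>i < j\<close> that by (intro disj) auto
      ultimately have "translate 0 2 ` set (\<pi> (i - 1)) \<inter> translate 0 2 ` set (\<pi> (j - 1)) = {}"
        if "i \<noteq> 1"
        using that by (simp add: image_Int[symmetric])
      then show ?thesis
        by (simp add: U_def)
    qed
    ultimately show ?thesis
      using that by (auto simp: set)
  qed
  then have "nonintersecting (Suc n) (lift_family n \<pi>)"
    unfolding nonintersecting_def by (intro ballI impI) (metis Int_commute linorder_neqE_nat)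
  moreover have "lift_family n \<pi> \<in> extensional {1..Suc n}"
    by (simp add: lift_family_def)
  ultimately show ?thesis
    by (auto simp: small_families_def PiE_iff)
qed

text \<open>
  By parity, a vertex of \<open>\<omega> i\<close> on the axis has an odd abscissa \<open>\<plusminus>(2k - 1)\<close>, and one at height \<open>1\<close> has
  an even abscissa \<open>\<plusminus>(2k - 2)\<close>. In the given range \<open>k < i\<close>, and then the vertex is already occupied by
  the first two or the last two vertices of \<open>\<omega> k\<close>.
\<close>

lemma small_family_vertices_high:
  assumes \<omega>: "\<omega> \<in> small_families n" and i: "i \<in> {1..n}"
    and v: "(x, y) \<in> set (\<omega> i)" and x: "\<bar>x\<bar> \<le> 2 * int i - 3"
  shows "y \<ge> 2"
proof (rule ccontr)
  have path: "\<omega> k \<in> small_paths (- 2 * int k + 1) (2 * int k - 1)" if "k \<in> {1..n}" for k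
    using \<omega> that by (auto simp: small_families_def PiE_iff)
  assume "\<not> y \<ge> 2"
  moreover have large: "\<omega> i \<in> large_paths (- 2 * int i + 1) (2 * int i - 1)"
    using path[OF i] small_paths_subset by blast
  note y = large_path_vertex_bounds(3,6)[OF large v]
  ultimately have "y = 0 \<or> y = 1"
    using y(1) by linarith
  with y(2) consider "y = 0" "odd x" | "y = 1" "even x"
    by auto
  then obtain k where k: "k \<in> {1..n}" "k < i"
    "(x, y) \<in> {(- 2 * int k + 1, 0), (- 2 * int k + 2, 1), (2 * int k - 2, 1), (2 * int k - 1, 0)}"
  proof cases
    case 1
    then obtain l where l: "x = 2 * l + 1"
      by (auto elim: oddE)
    show ?thesis
    proof (cases "l \<ge> 0")
      case True
      with 1 l x i show ?thesis
        by (intro that[of "nat (l + 1)"]) auto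
    next
      case False
      with 1 l x i show ?thesis
        by (intro that[of "nat (- l)"]) auto
    qed
  next
    case 2
    then obtain l where l: "x = 2 * l"
      by (auto elim: evenE)
    show ?thesis
    proof (cases "l \<ge> 0")
      case True
      with 2 l x i show ?thesis
        by (intro that[of "nat (l + 1)"]) auto
    next
      case False
      with 2 l x i show ?thesis
        by (intro that[of "nat (- l + 1)"]) auto
    qed
  qed
  have "(x, y) \<in> set (\<omega> k)"
    using small_path_outer_vertices[OF path[OF k(1)]] k by auto
  moreover have "set (\<omega> k) \<inter> set (\<omega> i) = {}"
    using \<omega> k(1,2) i by (simp add: small_families_def nonintersecting_def)
  ultimately show False
    using v by blast
qed

text \<open>
  In a nonintersecting small family the innermost path can only be \<open>UD\<close>, and the others are
  forced to climb to height \<open>2\<close> before they are free to move. Stripping these forced steps leaves a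
  nonintersecting family of large paths with one path less.
\<close>

lemma bij_betw_lift_family: "bij_betw (lift_family n) (large_families n) (small_families (Suc n))"
  unfolding bij_betw_def
proof
  show "inj_on (lift_family n) (large_families n)"
  proof (rule inj_onI)
    fix \<pi> \<rho> assume \<pi>: "\<pi> \<in> large_families n" and \<rho>: "\<rho> \<in> large_families n"
      and eq: "lift_family n \<pi> = lift_family n \<rho>"
    have "\<pi> i = \<rho> i" if "i \<in> {1..n}" for i
    proof -
      have "lift_path (int (Suc i)) (\<pi> i) = lift_path (int (Suc i)) (\<rho> i)"
        using fun_cong[OF eq, of "Suc i"] that by (simp add: lift_family_def)
      then show ?thesis
        using inj_lift_path by (metis injD)
    qed
    then show "\<pi> = \<rho>"
      using \<pi> \<rho> unfolding large_families_def by (blast intro: PiE_ext)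
  qed
  show "lift_family n ` large_families n = small_families (Suc n)"
  proof (intro equalityI subsetI)
    fix \<omega> assume \<omega>: "\<omega> \<in> small_families (Suc n)"
    have path: "\<omega> k \<in> small_paths (- 2 * int k + 1) (2 * int k - 1)" if "k \<in> {1..Suc n}" for k
      using \<omega> that by (auto simp: small_families_def PiE_iff)
    have "\<exists>w. w \<in> large_paths (- 2 * int i + 1) (2 * int i - 1) \<and> \<omega> (Suc i) = lift_path (int (Suc i)) w"
      if "i \<in> {1..n}" for i
      using small_path_eq_lift_path[OF path[of "Suc i"]] that
        small_family_vertices_high[OF \<omega>, of "Suc i"]
      by (auto simp: algebra_simps)
    then obtain f where f: "f i \<in> large_paths (- 2 * int i + 1) (2 * int i - 1)"
      "\<omega> (Suc i) = lift_path (int (Suc i)) (f i)" if "i \<in> {1..n}" for i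
      by metis
    define \<pi> where "\<pi> = restrict f {1..n}"
    have "set (\<pi> i) \<inter> set (\<pi> j) = {}" if "i \<in> {1..n}" "j \<in> {1..n}" "i \<noteq> j" for i j
    proof -
      have "set (\<omega> (Suc i)) \<inter> set (\<omega> (Suc j)) = {}"
        using \<omega> that by (auto simp: small_families_def nonintersecting_def)
      moreover have "translate 0 2 ` set (f k) \<subseteq> set (\<omega> (Suc k))" if "k \<in> {1..n}" for k
        using f(2)[OF that] by (auto simp: lift_path_def)
      ultimately have "translate 0 2 ` set (f i) \<inter> translate 0 2 ` set (f j) = {}"
        using that by blast
      then show ?thesis
        using that by (auto simp: \<pi>_def)
    qed
    then have "\<pi> \<in> large_families n"
      using f(1) by (auto simp: large_families_def nonintersecting_def \<pi>_def PiE_iff)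
    moreover have "\<omega> = lift_family n \<pi>"
    proof
      fix i
      consider "i = 1" | "i \<noteq> 1" "i \<in> {1..Suc n}" | "i \<notin> {1..Suc n}"
        by blast
      then show "\<omega> i = lift_family n \<pi> i"
      proof cases
        case 1
        then show ?thesis
          using path[of 1] small_paths_unit by (simp add: lift_family_def)
      next
        case 2
        then obtain j where "j \<in> {1..n}" "i = Suc j"
          by (cases i) auto
        then show ?thesis
          using f(2) by (simp add: lift_family_def \<pi>_def)
      next
        case 3
        then show ?thesis
          using \<omega> by (auto simp: small_families_def lift_family_def PiE_iff extensional_def)
      qed
    qed
    ultimately show "\<omega> \<in> lift_family n ` large_families n"
      by blast
  qed (auto intro: lift_family_small)
qed

section \<open>Determinants and the evaluation\<close>

text \<open>
  The end points with indices counted from \<open>0\<close>, as for the matrices.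
\<close>

definition source :: "nat \<Rightarrow> int \<times> int" where
  "source i = (- 2 * int i - 1, 0)"

definition sink :: "nat \<Rightarrow> int \<times> int" where
  "sink i = (2 * int i + 1, 0)"

text \<open>
  Take the least \<open>i\<close> that is moved and its preimage \<open>j\<close>: everything below \<open>i\<close> is fixed, so \<open>i < j\<close>
  and \<open>\<sigma> j = i < \<sigma> i\<close>.
\<close>

lemma nonid_permutation_has_inversion:
  fixes n :: nat
  assumes \<sigma>: "\<sigma> permutes {0..<n}" and "\<sigma> \<noteq> id"
  obtains i j where "i < j" "j < n" "\<sigma> j < \<sigma> i"
proof -
  have inj: "inj \<sigma>"
    using \<sigma> by (rule permutes_inj)
  define i where "i = (LEAST i. \<sigma> i \<noteq> i)"
  have "\<exists>i. \<sigma> i \<noteq> i"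
    using assms(2) by (auto simp: fun_eq_iff)
  then have i: "\<sigma> i \<noteq> i"
    unfolding i_def by (rule LeastI_ex[of "\<lambda>i. \<sigma> i \<noteq> i"])
  have fixed: "\<sigma> k = k" if "k < i" for k
    using not_less_Least that unfolding i_def by blast
  obtain j where j: "\<sigma> j = i"
    using permutes_surj[OF \<sigma>] by (metis surjD)
  have "i < j"
    using fixed[of j] i j by (cases i j rule: linorder_cases) auto
  moreover have "\<sigma> j < \<sigma> i"
    using fixed[of "\<sigma> i"] injD[OF inj, of "\<sigma> i" i] i j
    by (cases "\<sigma> i" i rule: linorder_cases) auto
  moreover have "j < n"
    using permutes_not_in[OF \<sigma>, of j] j \<open>i < j\<close> by force
  ultimately show ?thesis
    using that by blast
qed

text \<open>
  At an inversion the path from the outer source ends at the inner sink and vice versa, and two such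
  paths cross.
\<close>

lemma disjoint_families_are_id:
  assumes large: "\<And>a b. paths E (a, 0) (b, 0) \<subseteq> large_paths a b"
    and \<sigma>: "\<sigma> permutes {0..<n}" and \<pi>: "\<pi> \<in> families E source sink {0..<n} \<sigma>"
    and disj: "disjoint_family_on (\<lambda>k. set (\<pi> k)) {0..<n}"
  shows "\<sigma> = id"
proof (rule ccontr)
  assume "\<sigma> \<noteq> id"
  with \<sigma> obtain i j where ij: "i < j" "j < n" "\<sigma> j < \<sigma> i"
    by (rule nonid_permutation_has_inversion)
  have path: "\<pi> k \<in> large_paths (- 2 * int k - 1) (2 * int (\<sigma> k) + 1)" if "k < n" for k
    using \<pi> that large by (fastforce simp: families_def PiE_iff source_def sink_def)
  have "set (\<pi> j) \<inter> set (\<pi> i) \<noteq> {}"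
    by (rule large_paths_cross[OF path[of j] path[of i]]) (use ij in auto)
  with disj ij show False
    by (auto simp: disjoint_family_on_def)
qed

lemma card_disjoint_families_Suc:
  "card {\<pi> \<in> (\<Pi>\<^sub>E i\<in>{1..n}. F i). nonintersecting n \<pi>} =
   card {\<rho> \<in> (\<Pi>\<^sub>E i\<in>{0..<n}. F (Suc i)). disjoint_family_on (\<lambda>k. set (\<rho> k)) {0..<n}}"
proof -
  let ?f = "\<lambda>\<pi> :: nat \<Rightarrow> path. \<lambda>i\<in>{0..<n}. \<pi> (Suc i)" and ?g = "\<lambda>\<rho> :: nat \<Rightarrow> path. \<lambda>i\<in>{1..n}. \<rho> (i - 1)"
  let ?A = "{\<pi> \<in> (\<Pi>\<^sub>E i\<in>{1..n}. F i). nonintersecting n \<pi>}"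
  let ?B = "{\<rho> \<in> (\<Pi>\<^sub>E i\<in>{0..<n}. F (Suc i)). disjoint_family_on (\<lambda>k. set (\<rho> k)) {0..<n}}"
  have "bij_betw ?f ?A ?B"
  proof (rule bij_betw_byWitness[of _ ?g])
    show "\<forall>\<pi>\<in>?A. ?g (?f \<pi>) = \<pi>"
      by (auto simp: PiE_iff extensional_def fun_eq_iff)
    show "\<forall>\<rho>\<in>?B. ?f (?g \<rho>) = \<rho>"
      by (auto simp: PiE_iff extensional_def fun_eq_iff)
    show "?f ` ?A \<subseteq> ?B"
    proof clarify
      fix \<pi> assume \<pi>: "\<pi> \<in> (\<Pi>\<^sub>E i\<in>{1..n}. F i)" and disj: "nonintersecting n \<pi>"
      have "set (\<pi> (Suc i)) \<inter> set (\<pi> (Suc j)) = {}" if "i < n" "j < n" "i \<noteq> j" for i j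
        using disj that by (simp add: nonintersecting_def)
      with \<pi> show "?f \<pi> \<in> (\<Pi>\<^sub>E i\<in>{0..<n}. F (Suc i)) \<and>
          disjoint_family_on (\<lambda>k. set (?f \<pi> k)) {0..<n}"
        by (simp add: PiE_iff disjoint_family_on_def)
    qed
    show "?g ` ?B \<subseteq> ?A"
    proof clarify
      fix \<rho> assume \<rho>: "\<rho> \<in> (\<Pi>\<^sub>E i\<in>{0..<n}. F (Suc i))"
        and disj: "disjoint_family_on (\<lambda>k. set (\<rho> k)) {0..<n}"
      have "\<rho> (i - 1) \<in> F i" if "i \<in> {1..n}" for i
        using PiE_mem[OF \<rho>, of "i - 1"] that by (cases i) auto
      moreover have "set (\<rho> (i - 1)) \<inter> set (\<rho> (j - 1)) = {}"
        if "i \<in> {1..n}" "j \<in> {1..n}" "i \<noteq> j" for i j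
        using disj that unfolding disjoint_family_on_def
        by (metis Suc_diff_1 Suc_le_lessD atLeastAtMost_iff atLeastLessThan_iff diff_Suc_1 le0 less_eq_Suc_le One_nat_def)
      ultimately show "?g \<rho> \<in> (\<Pi>\<^sub>E i\<in>{1..n}. F i) \<and> nonintersecting n (?g \<rho>)"
        by (auto simp: nonintersecting_def)
    qed
  qed
  then show ?thesis
    by (rule bij_betw_same_card)
qed

text \<open>
  The form of the determinant formula that serves large and small paths alike: \<open>E\<close> is one of the
  two step relations and \<open>c\<close> the sequence of its path counts.
\<close>

lemma card_nonintersecting_eq_det:
  assumes large: "\<And>a b. paths E (a, 0) (b, 0) \<subseteq> large_paths a b"
    and steps: "\<And>w. successively E w \<Longrightarrow> successively is_step w"
    and count: "\<And>a k. k > 0 \<Longrightarrow> card (paths E (a, 0) (a + 2 * int k, 0)) = c k"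
  shows "int (card {\<pi> \<in> (\<Pi>\<^sub>E i\<in>{1..n}. paths E (- 2 * int i + 1, 0) (2 * int i - 1, 0)). nonintersecting n \<pi>})
    = det (mat n n (\<lambda>(i, j). int (c (i + j + 1))))"
proof -
  have acyclic: "distinct w" if "successively E w" for w
    using is_step_distinct_abscissae[OF steps[OF that]] by (simp add: distinct_map)
  have fin: "finite (paths E (source i) (sink j))" for i j
    unfolding source_def sink_def by (rule finite_subset[OF large finite_large_paths])
  have entry: "card (paths E (source i) (sink j)) = c (i + j + 1)" for i j
    using count[of "i + j + 1" "- 2 * int i - 1"] by (simp add: source_def sink_def algebra_simps)
  have shift: "(- 2 * int (Suc i) + 1, 0) = source i" "(2 * int (Suc i) - 1, 0) = sink i" for i
    by (simp_all add: source_def sink_def)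
  have "card {\<pi> \<in> (\<Pi>\<^sub>E i\<in>{1..n}. paths E (- 2 * int i + 1, 0) (2 * int i - 1, 0)). nonintersecting n \<pi>}
    = card {\<pi> \<in> families E source sink {0..<n} id. disjoint_family_on (\<lambda>k. set (\<pi> k)) {0..<n}}"
    unfolding card_disjoint_families_Suc shift by (simp add: families_def)
  also have "int \<dots> = det (mat n n (\<lambda>(i, j). int (card (paths E (source i) (sink j)))))"
    by (rule lindstroem_gessel_viennot_nonpermutable[OF acyclic fin disjoint_families_are_id[OF large], symmetric])
  finally show ?thesis
    by (simp add: entry)
qed

lemma card_large_families: "int (card (large_families n)) = det (H1 n)"
  unfolding large_families_def H1_def large_paths_eq_paths
  by (rule card_nonintersecting_eq_det)
    (auto simp: card_large_paths large_paths_eq_paths[symmetric] intro: successively_large_stepD)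

lemma card_small_families: "int (card (small_families n)) = det (G1 n)"
  unfolding small_families_def G1_def small_paths_eq_paths
proof (rule card_nonintersecting_eq_det)
  show "paths small_step (a, 0) (b, 0) \<subseteq> large_paths a b" for a b
    using small_paths_subset by (simp add: small_paths_eq_paths)
qed (auto simp: card_small_paths small_paths_eq_paths[symmetric]
    intro: successively_large_stepD successively_small_stepD)

lemma det_H1_eq: "det (H1 n) = 2 ^ n * det (G1 n)"
proof -
  have "H1 n = 2 \<cdot>\<^sub>m G1 n"
    by (rule eq_matI) (auto simp: H1_def G1_def large_schroeder_eq_twice_small)
  then show ?thesis
    by (simp add: G1_def)
qed

text \<open>
  Passing from \<open>n\<close> to \<open>n + 1\<close>, the bijection trades large families for small ones with one more
  path, and the ratio \<open>2 ^ (n + 1)\<close> of the two determinants of size \<open>n + 1\<close> leads back to large families.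
\<close>

lemma card_families_eq_power:
  "card (large_families n) = 2 ^ (n * (n + 1) div 2) \<and>
   card (small_families (Suc n)) = 2 ^ (n * (n + 1) div 2)"
proof (induction n)
  have small: "card (small_families (Suc n)) = card (large_families n)" for n
    using bij_betw_same_card[OF bij_betw_lift_family] by metis
  {
    case 0
    have "large_families 0 = {\<lambda>_. undefined}"
      by (auto simp: large_families_def nonintersecting_def)
    then show ?case
      by (simp add: small)
  next
    case (Suc n)
    have "int (card (large_families (Suc n))) = int (2 ^ Suc n * card (small_families (Suc n)))"
      by (simp add: card_large_families card_small_families det_H1_eq)
    then have "card (large_families (Suc n)) = 2 ^ Suc n * card (small_families (Suc n))"
      by (simp only: of_nat_eq_iff)
    also have "\<dots> = 2 ^ (Suc n + n * (n + 1) div 2)"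
      using Suc by (simp add: power_add)
    also have "Suc n + n * (n + 1) div 2 = Suc n * (Suc n + 1) div 2"
      by (simp add: algebra_simps)
    finally show ?case
      using small by simp
  }
qed

theorem proposition2p1:
  fixes n :: nat
  assumes "n \<ge> 1"
  shows "(int (card (large_families n)) = det (H1 n) \<and> det (H1 n) = 2 ^ (n * (n + 1) div 2)) \<and>
         (int (card (small_families n)) = det (G1 n) \<and> det (G1 n) = 2 ^ (n * (n - 1) div 2))"
proof -
  obtain m where m: "n = Suc m"
    using assms by (cases n) auto
  have "int (card (large_families n)) = 2 ^ (n * (n + 1) div 2)"
    using card_families_eq_power[of n] by simp
  moreover have "int (card (small_families n)) = 2 ^ (n * (n - 1) div 2)"
    using card_families_eq_power[of m] by (simp add: m mult.commute)
  ultimately show ?thesis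
    by (simp add: card_large_families card_small_families)
qed

end
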